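(* Let $q,t$ be natural numbers with $\gcd(t,q)=1$, and let $a$ be an integer with $\gcd(a,q)=1$ such that $t$ divides $a^2+1$. Put $b=q(a^2+1)/t$. Then $$S(a,b)=\frac{(q^2-1)a}{tq}-S(aq,t)+S(at^*,q),$$ where $t^*$ is any integer with $tt^*\equiv 1\pmod q$.
   Context: For $x\in\mathbb{R}$ let $((x))=x-\lfloor x\rfloor-1/2$ if $x\notin\mathbb{Z}$ and $((x))=0$ if $x\in\mathbb{Z}$. For $a\in\mathbb{Z}$, $b\in\mathbb{N}$ with $\gcd(a,b)=1$, the classical Dedekind sum is $s(a,b)=\sum_{j=1}^{b}((j/b))((aj/b))$, and the normalized Dedekind sum is $S(a,b)=12\,s(a,b)$. *)

theory Defs
  imports Complex_Main "HOL-Number_Theory.Cong"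
begin

definition sawtooth :: "real \<Rightarrow> real" where
  "sawtooth x = (if x \<in> \<int> then 0 else x - of_int \<lfloor>x\<rfloor> - 1 / 2)"

text \<open>The classical sum is only considered for coprime arguments with \<open>b \<ge> 1\<close>;
  the definitions below are total, and this side condition is left to their uses.\<close>

definition dedekind_s :: "int \<Rightarrow> nat \<Rightarrow> real" where
  "dedekind_s a b =
     (\<Sum>j = 1..b. sawtooth (real j / real b) * sawtooth (of_int a * real j / real b))"

definition dedekind_S :: "int \<Rightarrow> nat \<Rightarrow> real" where
  "dedekind_S a b = 12 * dedekind_s a b"

end

theory Submission
  imports Defs
begin

text \<open>
  Rademacher's three-term reciprocity law for pairwise coprime \<open>a, b, c\<close> reads
  \<open>D(a;b,c) + D(b;c,a) + D(c;a,b) = - 1/4 + (a\<^sup>2 + b\<^sup>2 + c\<^sup>2) / (12abc)\<close>, where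
  \<open>D(a;b,c)\<close> is the sum of \<open>((bj/a)) ((cj/a))\<close> over \<open>j\<close> modulo \<open>a\<close>. To see it, put
  \<open>x = j/a - k/b\<close>, \<open>y = k/b - l/c\<close>, \<open>z = l/c - j/a\<close> and sum
  \<open>((x))((y)) + ((y))((z)) + ((z))((x))\<close> over all \<open>j, k, l\<close> modulo \<open>a, b, c\<close>. The distribution
  relation of the sawtooth turns this into minus the left-hand side. On the other hand
  \<open>x + y + z = 0\<close> forces \<open>((x)) + ((y)) + ((z)) = \<plusminus>1/2\<close> unless one of them is an integer, so the
  sum reduces to sums of squares, which the Chinese remainder theorem evaluates.

  For \<open>a > 0\<close> the theorem is the difference of this law for \<open>(a, b, 1)\<close> and for \<open>(a, t, q)\<close>:
  since \<open>b t \<equiv> q\<close> modulo \<open>a\<close>, the two sums modulo \<open>a\<close> agree, and since \<open>a\<^sup>2 \<equiv> - 1\<close> modulo \<open>t\<close>,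
  the sum modulo \<open>t\<close> is \<open>- s(aq,t)\<close>. The case \<open>a < 0\<close> follows because both sides are odd in \<open>a\<close>.
\<close>

section \<open>Periodicity and oddness of the sawtooth\<close>

lemma sawtooth_add_int: "sawtooth (x + of_int n) = sawtooth x"
  by (auto simp: sawtooth_def)

lemma sawtooth_minus: "sawtooth (- x) = - sawtooth x"
proof (cases "x \<in> \<int>")
  case False
  then have "\<lceil>x\<rceil> = \<lfloor>x\<rfloor> + 1"
    by (metis Ints_of_int ceiling_altdef)
  with False show ?thesis
    by (simp add: sawtooth_def floor_minus)
qed (simp add: sawtooth_def)

lemma sawtooth_of_unit_interval:
  assumes "0 < x" "x < 1"
  shows "sawtooth x = x - 1 / 2"
proof -
  have "\<lfloor>x\<rfloor> = 0"
    using assms by (simp add: floor_eq_iff)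
  moreover from this have "x \<notin> \<int>"
    using assms by (metis Ints_cases floor_of_int less_irrefl of_int_0)
  ultimately show ?thesis
    by (simp add: sawtooth_def)
qed

lemma sawtooth_cong_divide:
  fixes n u v :: int
  assumes "n > 0" "[u = v] (mod n)"
  shows "sawtooth (of_int u / of_int n) = sawtooth (of_int v / of_int n)"
proof -
  obtain k where "u = v + n * k"
    using assms(2) by (metis cong_iff_lin cong_sym)
  then have "of_int u / of_int n = of_int v / of_int n + (of_int k :: real)"
    using assms(1) by (simp add: field_simps)
  then show ?thesis
    by (simp add: sawtooth_add_int)
qed

section \<open>Sums over residues and the distribution relation\<close>

text \<open>Since \<open>u\<close> is invertible modulo \<open>n\<close>, the map \<open>k\<close>
  to \<open>u * k + v\<close> is injective on residues, hence a permutation of the finite set of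
  representatives.\<close>

lemma sum_residues_affine:
  fixes n u v :: int and f :: "int \<Rightarrow> 'a::comm_monoid_add"
  assumes n: "n > 0" and u: "coprime u n"
    and f: "\<And>i j. [i = j] (mod n) \<Longrightarrow> f i = f j"
  shows "(\<Sum>k\<in>{0..<n}. f (u * k + v)) = (\<Sum>k\<in>{0..<n}. f k)"
proof -
  let ?g = "\<lambda>k. (u * k + v) mod n"
  have inj: "inj_on ?g {0..<n}"
  proof (rule inj_onI)
    fix i j assume ij: "i \<in> {0..<n}" "j \<in> {0..<n}" "?g i = ?g j"
    then have "[u * i = u * j] (mod n)"
      by (metis cong_add_rcancel cong_def)
    then have "[i = j] (mod n)"
      using cong_mult_lcancel u by blast
    then show "i = j"
      using ij by (simp add: cong_def)
  qed
  have "?g ` {0..<n} = {0..<n}"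
    using inj n by (intro endo_inj_surj) auto
  then have "bij_betw ?g {0..<n} {0..<n}"
    using inj by (simp add: bij_betw_def)
  then have "(\<Sum>k\<in>{0..<n}. f (?g k)) = (\<Sum>k\<in>{0..<n}. f k)"
    by (rule sum.reindex_bij_betw)
  moreover have "f (?g k) = f (u * k + v)" for k
    by (rule f) simp
  ultimately show ?thesis
    by simp
qed

lemma sum_int_range:
  fixes n :: int
  assumes "n \<ge> 0"
  shows "(\<Sum>k\<in>{0..<n}. real_of_int k) = of_int n * (of_int n - 1) / 2"
  using assms
proof (induction n rule: int_ge_induct)
  case (step i)
  then have "{0..<i + 1} = insert i {0..<i}" by auto
  with step show ?case by (simp add: field_simps)
qed simp

lemma sum_squares_int_range:
  fixes n :: int
  assumes "n \<ge> 0"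
  shows "(\<Sum>k\<in>{0..<n}. (real_of_int k)\<^sup>2) = of_int n * (of_int n - 1) * (2 * of_int n - 1) / 6"
  using assms
proof (induction n rule: int_ge_induct)
  case (step i)
  then have "{0..<i + 1} = insert i {0..<i}" by auto
  with step show ?case by (simp add: field_simps power2_eq_square)
qed simp

text \<open>Shifting \<open>x\<close> by \<open>1/n\<close> only rotates the summands, so
  \<open>x\<close> may be replaced by \<open>r/n\<close> with \<open>0 \<le> r < 1\<close>. All
  arguments then lie in \<open>[0, 1)\<close>, where the sawtooth is linear except at 0, and an
  arithmetic progression remains.\<close>

lemma sawtooth_distribution:
  fixes n :: int and x :: real
  assumes n: "n > 0"
  shows "(\<Sum>k\<in>{0..<n}. sawtooth (x + of_int k / of_int n)) = sawtooth (of_int n * x)"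
proof -
  define m where "m = \<lfloor>of_int n * x\<rfloor>"
  define r where "r = of_int n * x - of_int m"
  have r: "0 \<le> r" "r < 1"
    unfolding r_def m_def by linarith+
  have x: "x = (of_int m + r) / of_int n"
    using n by (simp add: r_def)
  define f where "f = (\<lambda>k. sawtooth ((r + of_int k) / of_int n))"
  have f: "f i = f j" if ij: "[i = j] (mod n)" for i j
  proof -
    obtain k where "i = j + n * k"
      using ij by (metis cong_iff_lin cong_sym)
    then have "(r + of_int i) / of_int n = (r + of_int j) / of_int n + of_int k"
      using n by (simp add: field_simps)
    then show ?thesis
      by (simp add: f_def sawtooth_add_int)
  qed
  have "(\<Sum>k\<in>{0..<n}. sawtooth (x + of_int k / of_int n)) = (\<Sum>k\<in>{0..<n}. f (1 * k + m))"
    by (intro sum.cong) (auto simp: f_def x add_divide_distrib add_ac)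
  also have "\<dots> = (\<Sum>k\<in>{0..<n}. f k)"
    using n f by (intro sum_residues_affine) auto
  also have "\<dots> = sawtooth r"
  proof -
    have f_eq: "f k = (r + of_int k) / of_int n - 1 / 2"
      if "k \<in> {0..<n}" "0 < r + of_int k" for k
    proof -
      have "k + 1 \<le> n"
        using that by simp
      then have "real_of_int (k + 1) \<le> of_int n"
        by (simp only: of_int_le_iff)
      then show ?thesis
        unfolding f_def using that r n
        by (intro sawtooth_of_unit_interval) auto
    qed
    have total: "(\<Sum>k\<in>{0..<n}. (r + of_int k) / of_int n - 1 / 2) = r - 1 / 2"
    proof -
      have "(\<Sum>k\<in>{0..<n}. (r + of_int k) / of_int n - 1 / 2) =
          (of_int n * r + (\<Sum>k\<in>{0..<n}. of_int k)) / of_int n - of_int n / 2"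
        using n by (simp add: sum_subtractf sum.distrib flip: sum_divide_distrib)
      also have "\<dots> = r - 1 / 2"
        using n unfolding sum_int_range[OF less_imp_le[OF n]] by (simp add: field_simps)
      finally show ?thesis .
    qed
    show ?thesis
    proof (cases "r = 0")
      case False
      then have "(\<Sum>k\<in>{0..<n}. f k) = (\<Sum>k\<in>{0..<n}. (r + of_int k) / of_int n - 1 / 2)"
        using r by (intro sum.cong refl f_eq) (auto intro: add_pos_nonneg)
      then show ?thesis
        using total False r by (simp add: sawtooth_of_unit_interval)
    next
      \<comment> \<open>For \<open>r = 0\<close> the summand at \<open>k = 0\<close> sits at an
        integer and is 0, while the linear formula gives -1/2 there. Removing this -1/2 from the
        total \<open>r - 1/2\<close> leaves 0, the value of the sawtooth at
        \<open>r\<close>.\<close>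
      case True
      have split: "{0..<n} = insert 0 {1..<n}"
        using n by auto
      have "(\<Sum>k\<in>{1..<n}. f k) = (\<Sum>k\<in>{1..<n}. (r + of_int k) / of_int n - 1 / 2)"
        using True by (intro sum.cong refl f_eq) auto
      then show ?thesis
        using total True unfolding split by (simp add: f_def sawtooth_def)
    qed
  qed
  also have "\<dots> = sawtooth (of_int n * x)"
    using sawtooth_add_int[of r m] by (simp add: r_def)
  finally show ?thesis .
qed

lemma sawtooth_distribution_minus:
  fixes n :: int and x :: real
  assumes "n > 0"
  shows "(\<Sum>k\<in>{0..<n}. sawtooth (x - of_int k / of_int n)) = sawtooth (of_int n * x)"
proof -
  have "(\<Sum>k\<in>{0..<n}. sawtooth (x - of_int k / of_int n)) =
      - (\<Sum>k\<in>{0..<n}. sawtooth (- x + of_int k / of_int n))"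
    unfolding sum_negf[symmetric] by (intro sum.cong refl) (simp flip: sawtooth_minus)
  then show ?thesis
    using sawtooth_distribution[OF assms, of "- x"] by (simp add: sawtooth_minus)
qed

section \<open>Sums of squares of the sawtooth\<close>

text \<open>The extra \<open>1/4\<close> at integers makes this the square of the 1-periodic function equal to
  \<open>x - 1/2\<close> on \<open>[0, 1)\<close>, so that its sums over residues need no exceptional term.\<close>

definition sawtooth_sq :: "real \<Rightarrow> real" where
  "sawtooth_sq x = (sawtooth x)\<^sup>2 + (if x \<in> \<int> then 1 / 4 else 0)"

lemma sawtooth_sq_add_int: "sawtooth_sq (x + of_int n) = sawtooth_sq x"
  by (simp add: sawtooth_sq_def sawtooth_add_int)

lemma sum_sawtooth_sq:
  fixes n :: int
  assumes n: "n > 0"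
  shows "(\<Sum>k\<in>{0..<n}. sawtooth_sq (of_int k / of_int n)) = ((of_int n)\<^sup>2 + 2) / (12 * of_int n)"
proof -
  have "sawtooth_sq (of_int k / of_int n) = (of_int k / of_int n - 1 / 2)\<^sup>2"
    if "k \<in> {0..<n}" for k
  proof (cases "k = 0")
    case False
    then have k: "0 < of_int k / real_of_int n" "of_int k / real_of_int n < 1"
      using that by auto
    then have "of_int k / real_of_int n \<notin> \<int>"
      by (metis Ints_cases of_int_0_less_iff of_int_less_1_iff zless_imp_add1_zle
          add_0 not_less)
    with k show ?thesis
      by (simp add: sawtooth_sq_def sawtooth_of_unit_interval)
  qed (simp add: sawtooth_sq_def sawtooth_def power2_eq_square)
  then have "(\<Sum>k\<in>{0..<n}. sawtooth_sq (of_int k / of_int n)) =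
      (\<Sum>k\<in>{0..<n}. (of_int k)\<^sup>2 / (of_int n)\<^sup>2 - of_int k / of_int n + 1 / 4)"
    by (intro sum.cong) (auto simp: power2_diff power_divide)
  also have "\<dots> = (\<Sum>k\<in>{0..<n}. (of_int k)\<^sup>2) / (of_int n)\<^sup>2
      - (\<Sum>k\<in>{0..<n}. of_int k) / of_int n + of_int n / 4"
    using n by (simp add: sum_subtractf sum.distrib sum_divide_distrib)
  also have "\<dots> = ((of_int n)\<^sup>2 + 2) / (12 * of_int n)"
    using n unfolding sum_int_range[OF less_imp_le[OF n]] sum_squares_int_range[OF less_imp_le[OF n]]
    by (simp add: field_simps power2_eq_square)
  finally show ?thesis .
qed

text \<open>The number \<open>j * b - k * a\<close> is the numerator of \<open>j/a - k/b\<close>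
  over the denominator \<open>a * b\<close>. Modulo \<open>a\<close> it determines \<open>j\<close>,
  modulo \<open>b\<close> it determines \<open>k\<close>; surjectivity follows by counting.\<close>

lemma chinese_remainder_bij_betw:
  fixes a b :: int
  assumes ab: "a > 0" "b > 0" and cop: "coprime a b"
  shows "bij_betw (\<lambda>(j, k). (j * b - k * a) mod (a * b)) ({0..<a} \<times> {0..<b}) {0..<a * b}"
proof -
  let ?g = "\<lambda>(j, k). (j * b - k * a) mod (a * b)"
  have inj: "inj_on ?g ({0..<a} \<times> {0..<b})"
  proof (rule inj_onI, clarify)
    fix j k j' k'
    assume *: "j \<in> {0..<a}" "k \<in> {0..<b}" "j' \<in> {0..<a}" "k' \<in> {0..<b}"
      and "(j * b - k * a) mod (a * b) = (j' * b - k' * a) mod (a * b)"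
    then have dvd: "a * b dvd (j - j') * b - (k - k') * a"
      by (simp add: mod_eq_dvd_iff algebra_simps)
    have "a dvd (j - j') * b"
      using dvd_mult_left[OF dvd] by (simp add: dvd_diff_left_iff)
    then have "[j = j'] (mod a)"
      using cop by (simp add: cong_iff_dvd_diff coprime_dvd_mult_left_iff)
    moreover have "b dvd (k - k') * a"
      using dvd_mult_right[OF dvd] by (simp add: dvd_diff_right_iff)
    then have "[k = k'] (mod b)"
      using cop by (simp add: cong_iff_dvd_diff coprime_dvd_mult_left_iff coprime_commute)
    ultimately show "j = j' \<and> k = k'"
      using * by (simp add: cong_def)
  qed
  moreover have "?g ` ({0..<a} \<times> {0..<b}) = {0..<a * b}"
  proof (rule card_subset_eq)
    show "card (?g ` ({0..<a} \<times> {0..<b})) = card {0..<a * b}"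
      using ab by (simp add: card_image[OF inj] card_cartesian_product nat_mult_distrib)
  qed (use ab in auto)
  ultimately show ?thesis
    by (simp add: bij_betw_def)
qed

lemma sum_sawtooth_sq_diff:
  fixes a b :: int
  assumes ab: "a > 0" "b > 0" and cop: "coprime a b"
  shows "(\<Sum>j\<in>{0..<a}. \<Sum>k\<in>{0..<b}. sawtooth_sq (of_int j / of_int a - of_int k / of_int b)) =
    ((of_int (a * b))\<^sup>2 + 2) / (12 * of_int (a * b))"
proof -
  let ?h = "\<lambda>n. sawtooth_sq (of_int n / of_int (a * b))"
  let ?g = "\<lambda>(j, k). (j * b - k * a) mod (a * b)"
  have h: "sawtooth_sq (of_int j / of_int a - of_int k / of_int b) = ?h (?g (j, k))" for j k
  proof -
    define r where "r = ?g (j, k)"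
    \<comment> \<open>The quotient \<open>m\<close> is what reducing the numerator modulo
      \<open>a * b\<close> discards; it changes the argument by an integer only.\<close>
    define m where "m = (j * b - k * a) div (a * b)"
    have "j * b - k * a = r + m * (a * b)"
      by (simp only: r_def m_def prod.case mod_div_mult_eq)
    then have "real_of_int (j * b - k * a) = of_int (r + m * (a * b))"
      by (simp only:)
    then have "of_int j / of_int a - of_int k / of_int b = of_int r / real_of_int (a * b) + of_int m"
      using ab by (simp add: field_simps)
    then show ?thesis
      by (simp only: sawtooth_sq_add_int r_def)
  qed
  have "(\<Sum>j\<in>{0..<a}. \<Sum>k\<in>{0..<b}. sawtooth_sq (of_int j / of_int a - of_int k / of_int b)) =
      (\<Sum>p\<in>{0..<a} \<times> {0..<b}. ?h (?g p))"
    by (simp add: h sum.cartesian_product split_def)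
  also have "\<dots> = (\<Sum>n\<in>{0..<a * b}. ?h n)"
    by (rule sum.reindex_bij_betw[OF chinese_remainder_bij_betw[OF ab cop]])
  also have "\<dots> = ((of_int (a * b))\<^sup>2 + 2) / (12 * of_int (a * b))"
    using ab by (intro sum_sawtooth_sq) simp
  finally show ?thesis .
qed

section \<open>The sawtooth at three numbers with sum zero\<close>

text \<open>Twice the sum of products is the square of the sum minus the sum of squares. If none of
  the numbers is an integer, the square of the sum is 1/4. If exactly one is, the sum is 0 and the
  1/4 is offset by the correction in \<open>sawtooth_sq\<close>. If all are, three corrections total
  3/4, which the extra 1/2 balances.\<close>

lemma sawtooth_products:
  fixes x y z :: real
  assumes "x + y + z = 0"
  shows "2 * (sawtooth x * sawtooth y + sawtooth y * sawtooth z + sawtooth z * sawtooth x) =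
    1 / 4 + (if x \<in> \<int> \<and> y \<in> \<int> then 1 / 2 else 0)
      - (sawtooth_sq x + sawtooth_sq y + sawtooth_sq z)"
proof -
  have z: "z = - (x + y)"
    using assms by simp
  have opposite: "sawtooth v = - sawtooth u" if "u + v \<in> \<int>" for u v
    by (metis that Ints_cases sawtooth_add_int sawtooth_minus
        diff_add_cancel minus_diff_eq add_diff_cancel_left')
  \<comment> \<open>Two integers among the three force the third to be one, so exactly two integers
    never occur.\<close>
  consider "x \<in> \<int>" "y \<in> \<int>" "z \<in> \<int>" | "x \<in> \<int>" "y \<notin> \<int>" "z \<notin> \<int>" | "x \<notin> \<int>" "y \<in> \<int>" "z \<notin> \<int>"
    | "x \<notin> \<int>" "y \<notin> \<int>" "z \<in> \<int>" | "x \<notin> \<int>" "y \<notin> \<int>" "z \<notin> \<int>"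
    using assms unfolding z
    by (metis Ints_add Ints_minus Ints_diff add_diff_cancel_left' add_diff_cancel_right' minus_minus)
  then show ?thesis
  proof cases
    case 1
    then show ?thesis
      by (simp add: sawtooth_sq_def sawtooth_def)
  next
    case 2
    then have "sawtooth z = - sawtooth y"
      using assms by (intro opposite) (metis Ints_minus minus_unique add.assoc)
    with 2 show ?thesis
      by (simp add: sawtooth_sq_def sawtooth_def[of x] power2_eq_square)
  next
    case 3
    then have "sawtooth z = - sawtooth x"
      using assms by (intro opposite) (metis Ints_minus minus_unique add.assoc add.commute)
    with 3 show ?thesis
      by (simp add: sawtooth_sq_def sawtooth_def[of y] power2_eq_square)
  next
    case 4
    then have "sawtooth y = - sawtooth x"
      by (intro opposite) (metis Ints_minus z minus_minus)
    with 4 show ?thesis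
      by (simp add: sawtooth_sq_def sawtooth_def[of z] power2_eq_square)
  next
    case 5
    \<comment> \<open>The fractional parts add up to an integer strictly between 0 and 3, hence to 1
      or 2, and \<open>s\<close> is this integer minus 3/2.\<close>
    define s where "s = sawtooth x + sawtooth y + sawtooth z"
    have frac: "sawtooth u = frac u - 1 / 2" "0 < frac u" "frac u < 1" if "u \<notin> \<int>" for u
      using that by (simp_all add: sawtooth_def frac_def[symmetric] frac_lt_1)
    have "s + 3 / 2 = frac x + frac y + frac z"
      using 5 by (simp add: s_def frac)
    moreover have "frac x + frac y + frac z = of_int (- \<lfloor>x\<rfloor> - \<lfloor>y\<rfloor> - \<lfloor>z\<rfloor>)"
      using assms by (simp add: frac_def)
    then obtain m :: int where m: "frac x + frac y + frac z = of_int m"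
      by blast
    moreover have "0 < real_of_int m" "real_of_int m < 3"
      using frac(2,3)[OF 5(1)] frac(2,3)[OF 5(2)] frac(2,3)[OF 5(3)] unfolding m[symmetric]
      by linarith+
    then have "m = 1 \<or> m = 2"
      by linarith
    ultimately have "s = - 1 / 2 \<or> s = 1 / 2"
      by auto
    then have "(s + 1 / 2) * (s - 1 / 2) = 0"
      by auto
    then have "s\<^sup>2 = 1 / 4"
      by (simp add: algebra_simps power2_eq_square)
    with 5 show ?thesis
      by (simp add: s_def sawtooth_sq_def power2_eq_square algebra_simps)
  qed
qed

section \<open>Dedekind sums with three parameters\<close>

text \<open>This is \<open>D(a;b,c)\<close>, with the representatives starting at 0 to match the
  sums over residues.\<close>

definition dedekind_sum3 :: "int \<Rightarrow> int \<Rightarrow> int \<Rightarrow> real" where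
  "dedekind_sum3 a b c =
     (\<Sum>j\<in>{0..<a}. sawtooth (of_int (b * j) / of_int a) * sawtooth (of_int (c * j) / of_int a))"

lemma dedekind_sum3_commute: "dedekind_sum3 a b c = dedekind_sum3 a c b"
  by (simp add: dedekind_sum3_def mult.commute)

lemma dedekind_sum3_cong:
  assumes "a > 0" "[b = b'] (mod a)" "[c = c'] (mod a)"
  shows "dedekind_sum3 a b c = dedekind_sum3 a b' c'"
  unfolding dedekind_sum3_def using assms
  by (intro sum.cong refl arg_cong2[of _ _ _ _ "(*)"] sawtooth_cong_divide cong_mult cong_refl)

lemma dedekind_sum3_minus: "dedekind_sum3 a b (- c) = - dedekind_sum3 a b c"
  by (simp add: dedekind_sum3_def sawtooth_minus sum_negf)

text \<open>Multiplication of the summation index by the unit \<open>u\<close> permutes the residues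
  modulo \<open>a\<close>.\<close>

lemma dedekind_sum3_scale:
  assumes "a > 0" "coprime u a"
  shows "dedekind_sum3 a (b * u) (c * u) = dedekind_sum3 a b c"
proof -
  let ?f = "\<lambda>j. sawtooth (of_int (b * j) / of_int a) * sawtooth (of_int (c * j) / of_int a)"
  have "(\<Sum>j\<in>{0..<a}. ?f (u * j + 0)) = (\<Sum>j\<in>{0..<a}. ?f j)"
    using assms
    by (intro sum_residues_affine arg_cong2[of _ _ _ _ "(*)"] sawtooth_cong_divide cong_mult cong_refl)
  then show ?thesis
    by (simp add: dedekind_sum3_def mult.assoc)
qed

lemma dedekind_s_eq_sum3:
  assumes "n \<ge> 1"
  shows "dedekind_s h n = dedekind_sum3 (int n) h 1"
proof -
  let ?f = "\<lambda>j. sawtooth (of_int (h * j) / of_int (int n)) * sawtooth (of_int (1 * j) / of_int (int n))"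
  have "dedekind_s h n = (\<Sum>j=1..n. ?f (int j))"
    by (simp add: dedekind_s_def mult.commute)
  \<comment> \<open>The classical range ends at \<open>n\<close>, the other one starts at 0. Both
    boundary terms vanish because their arguments are integers, so one can be exchanged for the
    other.\<close>
  also have "{1..n} = insert n {1..<n}"
    using assms by auto
  also have "(\<Sum>j\<in>insert n {1..<n}. ?f (int j)) = (\<Sum>j\<in>{1..<n}. ?f (int j))"
    using assms by (simp add: sawtooth_def)
  also have "\<dots> = (\<Sum>j\<in>insert 0 {1..<n}. ?f (int j))"
    by (simp add: sawtooth_def)
  also have "insert 0 {1..<n} = {0..<n}"
    using assms by auto
  also have "(\<Sum>j\<in>{0..<n}. ?f (int j)) = (\<Sum>j\<in>int ` {0..<n}. ?f j)"
    by (subst sum.reindex) auto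
  also have "int ` {0..<n} = {0..<int n}"
    by (simp add: image_int_atLeastLessThan)
  finally show ?thesis
    by (simp add: dedekind_sum3_def)
qed

text \<open>Only \<open>k\<close> occurs in both factors. The sums over \<open>j\<close> and
  \<open>l\<close> therefore separate, and each collapses by the distribution relation; the sign
  comes from oddness, as \<open>k/b\<close> enters the first factor negatively.\<close>

lemma sum_sawtooth_diff_products:
  fixes a b c :: int
  assumes "a > 0" "b > 0" "c > 0"
  shows "(\<Sum>j\<in>{0..<a}. \<Sum>k\<in>{0..<b}. \<Sum>l\<in>{0..<c}.
      sawtooth (of_int j / of_int a - of_int k / of_int b) *
      sawtooth (of_int k / of_int b - of_int l / of_int c)) = - dedekind_sum3 b c a"
proof -
  let ?X = "\<lambda>j k. sawtooth (of_int j / of_int a - of_int k / of_int b)"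
  let ?Y = "\<lambda>k l. sawtooth (of_int k / of_int b - of_int l / of_int c)"
  have X: "(\<Sum>j\<in>{0..<a}. ?X j k) = - sawtooth (of_int (a * k) / of_int b)" for k
    using sawtooth_distribution[OF assms(1), of "- (of_int k / of_int b)"]
    by (simp add: sawtooth_minus)
  have Y: "(\<Sum>l\<in>{0..<c}. ?Y k l) = sawtooth (of_int (c * k) / of_int b)" for k
    using sawtooth_distribution_minus[OF assms(3), of "of_int k / of_int b"] by simp
  have "(\<Sum>j\<in>{0..<a}. \<Sum>k\<in>{0..<b}. \<Sum>l\<in>{0..<c}. ?X j k * ?Y k l) =
      (\<Sum>k\<in>{0..<b}. \<Sum>j\<in>{0..<a}. ?X j k * (\<Sum>l\<in>{0..<c}. ?Y k l))"
    by (subst sum.swap) (simp add: sum_distrib_left)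
  also have "\<dots> = (\<Sum>k\<in>{0..<b}. (\<Sum>j\<in>{0..<a}. ?X j k) * (\<Sum>l\<in>{0..<c}. ?Y k l))"
    by (simp add: sum_distrib_right)
  also have "\<dots> = - dedekind_sum3 b c a"
    unfolding X Y by (simp add: dedekind_sum3_def sum_negf mult.commute)
  finally show ?thesis .
qed

text \<open>Clearing denominators gives \<open>a\<close> dividing \<open>j * b\<close> and
  \<open>b\<close> dividing \<open>k * a\<close>, and coprimality leaves only the zero
  representatives. This locates the exceptional term of \<open>sawtooth_products\<close> at the
  origin.\<close>

lemma diff_quotients_in_Ints_iff:
  fixes a b j k :: int
  assumes "coprime a b" "j \<in> {0..<a}" "k \<in> {0..<b}"
  shows "real_of_int j / of_int a - of_int k / of_int b \<in> \<int> \<longleftrightarrow> j = 0 \<and> k = 0"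
proof
  assume "real_of_int j / of_int a - of_int k / of_int b \<in> \<int>"
  then obtain m where "real_of_int j / of_int a - of_int k / of_int b = of_int m"
    by (elim Ints_cases)
  then have "real_of_int (j * b - k * a) = of_int (m * a * b)"
    using assms by (simp add: field_simps)
  then have eq: "j * b - k * a = m * a * b"
    by (simp only: of_int_eq_iff)
  have "j * b = (k + m * b) * a" "k * a = (j - m * a) * b"
    using eq by (simp_all add: algebra_simps)
  then have "a dvd j * b" "b dvd k * a"
    by simp_all
  then have "a dvd j" "b dvd k"
    using assms(1) by (simp_all add: coprime_dvd_mult_left_iff coprime_commute)
  then show "j = 0 \<and> k = 0"
    using assms(2,3) by (auto dest: zdvd_imp_le)
qed simp

section \<open>Rademacher's three-term reciprocity law\<close>

theorem rademacher_reciprocity: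
  fixes a b c :: int
  assumes pos: "a > 0" "b > 0" "c > 0"
    and cop: "coprime a b" "coprime b c" "coprime c a"
  shows "dedekind_sum3 a b c + dedekind_sum3 b c a + dedekind_sum3 c a b =
    - 1 / 4 + ((of_int a)\<^sup>2 + (of_int b)\<^sup>2 + (of_int c)\<^sup>2) / (of_int a * of_int b * of_int c) / 12"
proof -
  let ?x = "\<lambda>j k. real_of_int j / of_int a - of_int k / of_int b"
  let ?y = "\<lambda>k l. real_of_int k / of_int b - of_int l / of_int c"
  let ?z = "\<lambda>l j. real_of_int l / of_int c - of_int j / of_int a"
  let ?S = "\<lambda>f. \<Sum>j\<in>{0..<a}. \<Sum>k\<in>{0..<b}. \<Sum>l\<in>{0..<c}. (f j k l :: real)"
  have xy: "?S (\<lambda>j k l. sawtooth (?x j k) * sawtooth (?y k l)) = - dedekind_sum3 b c a"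
    using sum_sawtooth_diff_products[OF pos] .
  \<comment> \<open>Reordering the sums cyclically brings the shared index \<open>l\<close> into the
    middle, so that the product formula applies to \<open>(b, c, a)\<close>.\<close>
  have "?S (\<lambda>j k l. sawtooth (?y k l) * sawtooth (?z l j)) =
      (\<Sum>k\<in>{0..<b}. \<Sum>l\<in>{0..<c}. \<Sum>j\<in>{0..<a}. sawtooth (?y k l) * sawtooth (?z l j))"
    by (subst sum.swap) (intro sum.cong refl sum.swap)
  then have yz: "?S (\<lambda>j k l. sawtooth (?y k l) * sawtooth (?z l j)) = - dedekind_sum3 c a b"
    using sum_sawtooth_diff_products[OF pos(2,3,1)] by simp
  have "?S (\<lambda>j k l. sawtooth (?z l j) * sawtooth (?x j k)) =
      (\<Sum>j\<in>{0..<a}. \<Sum>l\<in>{0..<c}. \<Sum>k\<in>{0..<b}. sawtooth (?z l j) * sawtooth (?x j k))"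
    by (intro sum.cong refl sum.swap)
  also have "\<dots> = (\<Sum>l\<in>{0..<c}. \<Sum>j\<in>{0..<a}. \<Sum>k\<in>{0..<b}. sawtooth (?z l j) * sawtooth (?x j k))"
    by (rule sum.swap)
  finally have zx: "?S (\<lambda>j k l. sawtooth (?z l j) * sawtooth (?x j k)) = - dedekind_sum3 a b c"
    using sum_sawtooth_diff_products[OF pos(3,1,2)] by simp
  have sq_x: "?S (\<lambda>j k l. sawtooth_sq (?x j k)) =
      of_int c * (((of_int (a * b))\<^sup>2 + 2) / (12 * of_int (a * b)))"
    using pos sum_sawtooth_sq_diff[OF pos(1,2) cop(1)] by (simp flip: sum_distrib_left)
  have sq_y: "?S (\<lambda>j k l. sawtooth_sq (?y k l)) =
      of_int a * (((of_int (b * c))\<^sup>2 + 2) / (12 * of_int (b * c)))"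
    using pos sum_sawtooth_sq_diff[OF pos(2,3) cop(2)] by simp
  have "?S (\<lambda>j k l. sawtooth_sq (?z l j)) =
      of_int b * (\<Sum>j\<in>{0..<a}. \<Sum>l\<in>{0..<c}. sawtooth_sq (?z l j))"
    using pos by (simp add: sum_distrib_left)
  also have "(\<Sum>j\<in>{0..<a}. \<Sum>l\<in>{0..<c}. sawtooth_sq (?z l j)) =
      ((of_int (c * a))\<^sup>2 + 2) / (12 * of_int (c * a))"
    by (subst sum.swap) (rule sum_sawtooth_sq_diff[OF pos(3,1) cop(3)])
  finally have sq_z: "?S (\<lambda>j k l. sawtooth_sq (?z l j)) =
      of_int b * (((of_int (c * a))\<^sup>2 + 2) / (12 * of_int (c * a)))" .
  \<comment> \<open>The nested conditionals let each sum collapse to its zero index, so the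
    exceptional 1/2 is counted exactly once.\<close>
  have "?S (\<lambda>j k l. if ?x j k \<in> \<int> \<and> ?y k l \<in> \<int> then 1 / 2 else 0) =
      ?S (\<lambda>j k l. if j = 0 then if k = 0 then if l = 0 then 1 / 2 else 0 else 0 else 0)"
    using cop by (intro sum.cong refl) (simp add: diff_quotients_in_Ints_iff)
  also have "\<dots> = 1 / 2"
  proof -
    have "(\<Sum>i\<in>A. if P then f i else 0) = (if P then \<Sum>i\<in>A. f i else 0)"
      for A :: "int set" and P and f :: "int \<Rightarrow> real"
      by simp
    then show ?thesis
      using pos by simp
  qed
  finally have diag: "?S (\<lambda>j k l. if ?x j k \<in> \<int> \<and> ?y k l \<in> \<int> then 1 / 2 else 0) = 1 / 2" .
  have const: "?S (\<lambda>j k l. 1 / 4) = of_int (a * b * c) / 4"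
    using pos by simp
  have "?S (\<lambda>j k l. 2 * (sawtooth (?x j k) * sawtooth (?y k l)
        + sawtooth (?y k l) * sawtooth (?z l j) + sawtooth (?z l j) * sawtooth (?x j k))) =
      ?S (\<lambda>j k l. 1 / 4 + (if ?x j k \<in> \<int> \<and> ?y k l \<in> \<int> then 1 / 2 else 0)
        - (sawtooth_sq (?x j k) + sawtooth_sq (?y k l) + sawtooth_sq (?z l j)))"
    by (intro sum.cong refl sawtooth_products) simp
  then have "2 * (- dedekind_sum3 b c a - dedekind_sum3 c a b - dedekind_sum3 a b c) =
      of_int (a * b * c) / 4 + 1 / 2
      - (of_int c * (((of_int (a * b))\<^sup>2 + 2) / (12 * of_int (a * b)))
        + of_int a * (((of_int (b * c))\<^sup>2 + 2) / (12 * of_int (b * c)))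
        + of_int b * (((of_int (c * a))\<^sup>2 + 2) / (12 * of_int (c * a))))"
    unfolding sum_distrib_left[of "2 :: real", symmetric] sum.distrib sum_subtractf xy yz zx sq_x sq_y sq_z diag const
    by simp
  also have "\<dots> = 1 / 2 - ((of_int a)\<^sup>2 + (of_int b)\<^sup>2 + (of_int c)\<^sup>2) / (of_int a * of_int b * of_int c) / 6"
    using pos by (simp add: field_simps power2_eq_square)
  finally show ?thesis
    by simp
qed

section \<open>Specialization to classical Dedekind sums\<close>

lemma dedekind_sum3_one: "dedekind_sum3 1 b c = 0"
  by (simp add: dedekind_sum3_def sawtooth_def)

lemma dedekind_S_minus:
  assumes "n \<ge> 1"
  shows "dedekind_S (- h) n = - dedekind_S h n"
  using dedekind_sum3_minus[of "int n" 1 h]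
  by (simp add: dedekind_S_def dedekind_s_eq_sum3[OF assms] dedekind_sum3_commute[of _ _ 1])

text \<open>Here \<open>a\<close> is positive and can serve as a modulus. Subtracting the two
  reciprocity laws cancels the constants -1/4 and the sums modulo \<open>a\<close>.\<close>

lemma dedekind_S_pos:
  fixes q t b :: nat and a t' :: int
  assumes q: "q \<ge> 1" and t: "t \<ge> 1" and b: "b \<ge> 1" and a: "a > 0"
    and tq: "coprime (int t) (int q)" and aq: "coprime a (int q)"
    and bt: "int b * int t = int q * (a\<^sup>2 + 1)" and dvd: "int t dvd a\<^sup>2 + 1"
    and t': "[int t * t' = 1] (mod int q)"
  shows "dedekind_S a b =
    ((real q)\<^sup>2 - 1) * of_int a / (real t * real q)
      - dedekind_S (a * int q) t + dedekind_S (a * t') q"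
proof -
  have sq_coprime: "coprime (a\<^sup>2 + 1) a"
    by (metis coprime_1_left coprime_iff_gcd_eq_1 gcd_add_mult power2_eq_square gcd.commute)
  have at: "coprime a (int t)"
    using sq_coprime dvd by (meson coprime_commute coprime_divisors dvd_refl)
  have "coprime (int q * (a\<^sup>2 + 1)) a"
    using sq_coprime aq by (simp add: coprime_commute)
  then have ab: "coprime a (int b)"
    by (metis bt coprime_commute coprime_mult_left_iff)
  \<comment> \<open>Multiplying both parameters by the unit \<open>t\<close> turns
    \<open>(b, 1)\<close> into \<open>(q, t)\<close> modulo \<open>a\<close>.\<close>
  have mod_a: "dedekind_sum3 a (int b) 1 = dedekind_sum3 a (int t) (int q)"
  proof -
    have "[int b * int t = int q] (mod a)"
      unfolding bt by (simp add: cong_iff_dvd_diff algebra_simps power2_eq_square)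
    then have "dedekind_sum3 a (int b * int t) (1 * int t) = dedekind_sum3 a (int q) (int t)"
      using a by (intro dedekind_sum3_cong) auto
    then show ?thesis
      using at a dedekind_sum3_scale[of a "int t" "int b" 1]
      by (simp add: coprime_commute dedekind_sum3_commute[of a "int t"])
  qed
  \<comment> \<open>Multiplying by the unit \<open>a\<close> turns \<open>(q, a)\<close> into
    \<open>(a * q, -1)\<close> modulo \<open>t\<close>.\<close>
  have mod_t: "dedekind_sum3 (int t) (int q) a = - dedekind_s (a * int q) t"
  proof -
    have "dedekind_sum3 (int t) (int q) a = dedekind_sum3 (int t) (int q * a) (a * a)"
      using t at by (simp add: dedekind_sum3_scale)
    also have "\<dots> = dedekind_sum3 (int t) (a * int q) (- 1)"
      using t dvd by (intro dedekind_sum3_cong) (auto simp: cong_iff_dvd_diff power2_eq_square mult.commute)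
    finally show ?thesis
      using t by (simp add: dedekind_sum3_minus dedekind_s_eq_sum3)
  qed
  \<comment> \<open>Multiplying by \<open>t'\<close> turns \<open>(a, t)\<close> into
    \<open>(a * t', 1)\<close> modulo \<open>q\<close>.\<close>
  have mod_q: "dedekind_sum3 (int q) a (int t) = dedekind_s (a * t') q"
  proof -
    have "coprime t' (int q)"
      using t' by (metis coprime_iff_invertible_int mult.commute)
    then have "dedekind_sum3 (int q) a (int t) = dedekind_sum3 (int q) (a * t') (int t * t')"
      using q by (simp add: dedekind_sum3_scale)
    also have "\<dots> = dedekind_sum3 (int q) (a * t') 1"
      using q t' by (intro dedekind_sum3_cong) auto
    finally show ?thesis
      using q by (simp add: dedekind_s_eq_sum3)
  qed
  have rec_ab: "dedekind_sum3 a (int b) 1 + dedekind_s a b =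
      - 1 / 4 + ((of_int a)\<^sup>2 + (real b)\<^sup>2 + 1) / (of_int a * real b) / 12"
    using rademacher_reciprocity[of a "int b" 1] a b ab
    by (simp add: dedekind_s_eq_sum3 dedekind_sum3_one dedekind_sum3_commute[of "int b" 1])
  have rec_atq: "dedekind_sum3 a (int t) (int q) - dedekind_s (a * int q) t + dedekind_s (a * t') q =
      - 1 / 4 + ((of_int a)\<^sup>2 + (real t)\<^sup>2 + (real q)\<^sup>2) / (of_int a * real t * real q) / 12"
    using rademacher_reciprocity[of a "int t" "int q"] a t q at tq aq
    by (simp add: mod_t mod_q coprime_commute)
  have b_eq: "real b = real q * ((of_int a)\<^sup>2 + 1) / real t"
  proof -
    have "real_of_int (int b * int t) = of_int (int q * (a\<^sup>2 + 1))"
      by (simp only: bt)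
    then show ?thesis
      using t by (simp add: field_simps)
  qed
  have "((of_int a)\<^sup>2 + (real b)\<^sup>2 + 1) / (of_int a * real b)
      - ((of_int a)\<^sup>2 + (real t)\<^sup>2 + (real q)\<^sup>2) / (of_int a * real t * real q)
      = ((real q)\<^sup>2 - 1) * of_int a / (real t * real q)"
  proof -
    \<comment> \<open>With \<open>b = q * m / t\<close> a factor \<open>m\<close> cancels from the
      first fraction. Over the common denominator \<open>a * t * q\<close> the numerators then
      differ by \<open>q^2 * m - a^2 - q^2 = (q^2 - 1) * a^2\<close>.\<close>
    define m where "m = (real_of_int a)\<^sup>2 + 1"
    have "m > 0"
      unfolding m_def by (simp add: add_nonneg_pos)
    have "((of_int a)\<^sup>2 + (real b)\<^sup>2 + 1) / (of_int a * real b) =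
        (m + (real q * m / real t)\<^sup>2) / (of_int a * (real q * m / real t))"
      by (simp add: b_eq m_def add_ac)
    also have "\<dots> = ((real t)\<^sup>2 + (real q)\<^sup>2 * m) / (of_int a * real t * real q)"
      using \<open>m > 0\<close> a t q by (simp add: field_simps power2_eq_square)
    finally show ?thesis
      using a t q by (simp add: m_def field_simps power2_eq_square)
  qed
  then show ?thesis
    using rec_ab rec_atq mod_a by (simp add: dedekind_S_def)
qed

theorem theorem4:
  fixes q t b :: nat and a t' :: int
  assumes "q \<ge> 1" and "t \<ge> 1"
    and "coprime t q"
    and "coprime a (int q)"
    and "int t dvd a\<^sup>2 + 1"
    and "int b = int q * (a\<^sup>2 + 1) div int t"
    and "[int t * t' = 1] (mod int q)"
  shows "dedekind_S a b =
    ((real q)\<^sup>2 - 1) * of_int a / (real t * real q)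
      - dedekind_S (a * int q) t + dedekind_S (a * t') q"
proof -
  have bt: "int b * int t = int q * (a\<^sup>2 + 1)"
    using assms(5,6) by simp
  have "int q * (a\<^sup>2 + 1) > 0"
    using assms(1) by (intro mult_pos_pos) (auto intro: add_nonneg_pos)
  then have b: "b \<ge> 1"
    unfolding bt[symmetric] by (simp add: zero_less_mult_iff)
  have tq: "coprime (int t) (int q)"
    using assms(3) by simp
  consider "a > 0" | "a = 0" | "a < 0"
    by linarith
  then show ?thesis
  proof cases
    case 1
    show ?thesis
      by (rule dedekind_S_pos) (use assms b bt tq 1 in auto)
  next
    \<comment> \<open>For \<open>a = 0\<close> one factor of every summand is the sawtooth at 0, so
      both sides vanish.\<close>
    case 2
    then show ?thesis
      by (simp add: dedekind_S_def dedekind_s_def sawtooth_def)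
  next
    case 3
    \<comment> \<open>The hypotheses are insensitive to the sign of \<open>a\<close>, and all three
      Dedekind sums are odd in it.\<close>
    have "dedekind_S (- a) b =
      ((real q)\<^sup>2 - 1) * of_int (- a) / (real t * real q)
        - dedekind_S (- a * int q) t + dedekind_S (- a * t') q"
      by (rule dedekind_S_pos) (use assms b bt tq 3 in auto)
    then show ?thesis
      using assms(1,2) b by (simp add: dedekind_S_minus)
  qed
qed

end
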